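(* Let $P(x)=\sum_{i=0}^m a_i x^i$ be a polynomial of degree $m$ with nonnegative real coefficients, where $m$ is a positive integer. Suppose that $P(x)$ is non-decreasing, i.e. $a_0\le a_1\le\cdots\le a_m$, and that $d$ is a positive real number. Then the polynomial $P(x+d)$ is unimodal.
   Context: A sequence $b_0,\ldots,b_m$ of nonnegative real numbers is unimodal if there is an index $0\le t\le m$ such that $b_0\le\cdots\le b_{t-1}\le b_t\ge b_{t+1}\ge\cdots\ge b_m$. A polynomial with nonnegative coefficients is called unimodal if its sequence of coefficients (listed from the constant term to the leading coefficient) is unimodal. *)

theory Defs
  imports Complex_Main "HOL-Computational_Algebra.Polynomial"
begin

(* The finite sequence b 0, ..., b m; values of b beyond m are irrelevant. *)
definition unimodal_seq :: "(nat \<Rightarrow> real) \<Rightarrow> nat \<Rightarrow> bool" where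
  "unimodal_seq b m \<longleftrightarrow>
     (\<forall>i\<le>m. 0 \<le> b i) \<and>
     (\<exists>t\<le>m. (\<forall>i<t. b i \<le> b (Suc i)) \<and> (\<forall>i. t \<le> i \<and> i < m \<longrightarrow> b (Suc i) \<le> b i))"

definition unimodal_poly :: "real poly \<Rightarrow> bool" where
  "unimodal_poly P \<longleftrightarrow> unimodal_seq (coeff P) (degree P)"

end

theory Submission
  imports Defs
begin

text \<open>
  Write \<open>b j\<close> for the coefficients of \<open>P (x + d)\<close>. The point is that descents persist:
  once \<open>b (j + 1) \<le> b j\<close>, also \<open>b (j + 2) \<le> b (j + 1)\<close>, so everything before the first
  descent ascends and everything after it descends.

  By Taylor expansion \<open>j! * b j\<close> is the value at \<open>d\<close> of the \<open>j\<close>-th derivative of \<open>P\<close>.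
  The sign of \<open>b (j + 1) - b j\<close> is therefore the sign at \<open>d\<close> of
  \<open>E = P^(j + 1) - (j + 1) * P^(j)\<close>, the exponents in parentheses counting derivatives. Since the coefficients of \<open>P\<close> increase,
  every coefficient of \<open>E\<close> is nonnegative except that of \<open>x\<^sup>n\<close> with \<open>n = m - j\<close>, its
  highest power. For such a polynomial the Euler operator \<open>x * E'\<close> multiplies the
  negative term by \<open>n\<close> and the others by less, whence \<open>d * E' d \<le> n * E d\<close>. So
  \<open>E d \<le> 0\<close> forces \<open>E' d \<le> 0\<close>, and as \<open>E'\<close> is \<open>P^(j + 2) - (j + 1) * P^(j + 1)\<close> this says
  \<open>(j + 2) * b (j + 2) \<le> (j + 1) * b (j + 1)\<close>, slightly more than the next descent.
\<close>

lemma higher_pderiv_pcompose_shift: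
  fixes p :: "'a :: idom poly"
  shows "(pderiv ^^ j) (pcompose p [:d, 1:]) = pcompose ((pderiv ^^ j) p) [:d, 1:]"
  by (induction j) (simp_all add: pderiv_pcompose pderiv_pCons)

text \<open>Comparing the constant terms of both sides above yields the Taylor coefficients.\<close>

lemma fact_times_coeff_pcompose_shift:
  fixes p :: "'a :: {idom, semiring_char_0} poly"
  shows "fact j * coeff (pcompose p [:d, 1:]) j = poly ((pderiv ^^ j) p) d"
proof -
  have "fact j * coeff (pcompose p [:d, 1:]) j = coeff ((pderiv ^^ j) (pcompose p [:d, 1:])) 0"
    by (simp add: coeff_higher_pderiv pochhammer_fact)
  also have "\<dots> = poly ((pderiv ^^ j) p) d"
    by (simp add: higher_pderiv_pcompose_shift)
  finally show ?thesis .
qed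

lemma coeff_pcompose_shift_nonneg:
  fixes p :: "real poly" and d :: real
  assumes "\<And>i. 0 \<le> coeff p i" and "0 \<le> d"
  shows "0 \<le> coeff (pcompose p [:d, 1:]) j"
proof -
  have "0 \<le> poly ((pderiv ^^ j) p) d"
    using assms unfolding poly_altdef coeff_higher_pderiv
    by (intro sum_nonneg mult_nonneg_nonneg pochhammer_nonneg) auto
  then have "0 \<le> fact j * coeff (pcompose p [:d, 1:]) j"
    by (simp only: fact_times_coeff_pcompose_shift)
  then show ?thesis
    using fact_gt_zero[of j, where ?'a = real] by (auto simp: zero_le_mult_iff)
qed

lemma poly_eq_sum_upto:
  fixes p :: "'a :: comm_semiring_1 poly"
  assumes "degree p \<le> n"
  shows "poly p x = (\<Sum>i\<le>n. coeff p i * x ^ i)"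
  by (subst poly_as_sum_of_monoms'[OF assms, symmetric]) (simp add: poly_sum poly_monom)

text \<open>
  The operator \<open>x * d/dx\<close> scales the \<open>i\<close>-th term by \<open>i\<close>, which is at most \<open>n\<close>; only the
  term \<open>i = n\<close> may be negative, and there the scaling factor is exactly \<open>n\<close>.
\<close>

lemma euler_operator_le:
  fixes p :: "real poly" and x :: real
  assumes "degree p \<le> n" and "\<And>i. i < n \<Longrightarrow> 0 \<le> coeff p i" and "0 \<le> x"
  shows "x * poly (pderiv p) x \<le> real n * poly p x"
proof -
  have "x * poly (pderiv p) x = poly (pCons 0 (pderiv p)) x"
    by simp
  also have "\<dots> = (\<Sum>i\<le>n. real i * (coeff p i * x ^ i))"
  proof -
    have "coeff (pCons 0 (pderiv p)) i = real i * coeff p i" for i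
      by (simp add: coeff_pCons coeff_pderiv split: nat.split)
    moreover from this have "degree (pCons 0 (pderiv p)) \<le> n"
      using assms(1) by (intro degree_le) (auto simp: coeff_eq_0)
    ultimately show ?thesis
      by (simp add: poly_eq_sum_upto mult.assoc del: poly_pCons)
  qed
  also have "\<dots> \<le> (\<Sum>i\<le>n. real n * (coeff p i * x ^ i))"
  proof (rule sum_mono)
    fix i assume "i \<in> {..n}"
    then consider "i = n" | "i < n" by fastforce
    then show "real i * (coeff p i * x ^ i) \<le> real n * (coeff p i * x ^ i)"
      by cases (simp_all add: assms mult_right_mono)
  qed
  also have "\<dots> = real n * poly p x"
    by (simp add: poly_eq_sum_upto[OF assms(1)] sum_distrib_left)
  finally show ?thesis .
qed

text \<open>
  Because the coefficients of \<open>P\<close> increase, \<open>E\<close> has no negative coefficient below its top degree: its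
  coefficient at \<open>i\<close> compares \<open>(i + j + 1) * a (i + j + 1)\<close> with \<open>(j + 1) * a (i + j)\<close>, up to a
  positive factor, where \<open>a\<close> are the coefficients of \<open>P\<close>. At \<open>i = degree P - j\<close> only the
  negative part survives. This is the shape that \<open>euler_operator_le\<close> needs to carry the sign from
  \<open>E d\<close> to \<open>E' d\<close>.
\<close>

lemma descent_step:
  fixes P :: "real poly" and d :: real
  assumes nonneg: "\<And>i. 0 \<le> coeff P i"
    and incr: "\<And>i. i < degree P \<Longrightarrow> coeff P i \<le> coeff P (Suc i)"
    and "0 < d"
    and descent: "coeff (pcompose P [:d, 1:]) (Suc j) \<le> coeff (pcompose P [:d, 1:]) j"
  shows "coeff (pcompose P [:d, 1:]) (Suc (Suc j)) \<le> coeff (pcompose P [:d, 1:]) (Suc j)"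
proof -
  define b where "b = coeff (pcompose P [:d, 1:])"
  define D where "D = (\<lambda>j. (pderiv ^^ j) P)"
  define E where "E = D (Suc j) - smult (real (Suc j)) (D j)"
  have D: "poly (D i) d = fact i * b i" for i
    by (simp add: D_def b_def fact_times_coeff_pcompose_shift)
  have coeff_E: "coeff E i = pochhammer (real (Suc i)) j *
      (real (i + j + 1) * coeff P (Suc (i + j)) - real (j + 1) * coeff P (i + j))" for i
    unfolding E_def D_def coeff_diff coeff_smult coeff_higher_pderiv
    by (simp add: pochhammer_rec' algebra_simps)
  have "0 \<le> coeff E i" if "i < degree P - j" for i
  proof -
    have "real (j + 1) * coeff P (i + j) \<le> real (i + j + 1) * coeff P (Suc (i + j))"
      using that by (intro mult_mono incr) (auto simp: nonneg)
    then show ?thesis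
      unfolding coeff_E by (intro mult_nonneg_nonneg pochhammer_nonneg) auto
  qed
  moreover have "degree E \<le> degree P - j"
    by (rule degree_le) (auto simp: coeff_E coeff_eq_0)
  ultimately have "d * poly (pderiv E) d \<le> real (degree P - j) * poly E d"
    using \<open>0 < d\<close> by (intro euler_operator_le) auto
  also have "poly E d = fact (Suc j) * (b (Suc j) - b j)"
    by (simp add: E_def D algebra_simps)
  also have "real (degree P - j) * \<dots> \<le> 0"
    using descent unfolding b_def by (intro mult_nonneg_nonpos) auto
  finally have "poly (pderiv E) d \<le> 0"
    using \<open>0 < d\<close> by (simp add: mult_le_0_iff)
  moreover have "pderiv E = D (Suc (Suc j)) - smult (real (Suc j)) (D (Suc j))"
    by (simp add: E_def D_def pderiv_diff pderiv_smult)
  ultimately have "fact (Suc j) * (real (j + 2) * b (Suc (Suc j))) \<le> fact (Suc j) * (real (j + 1) * b (Suc j))"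
    by (simp add: D algebra_simps)
  then have *: "real (j + 2) * b (Suc (Suc j)) \<le> real (j + 1) * b (Suc j)"
    by (simp only: mult_le_cancel_left_pos fact_gt_zero)
  have "0 \<le> b (Suc j)"
    unfolding b_def using nonneg \<open>0 < d\<close> by (intro coeff_pcompose_shift_nonneg) auto
  then have "real (j + 1) * b (Suc j) \<le> real (j + 2) * b (Suc j)"
    by (intro mult_right_mono) auto
  with * have "real (j + 2) * b (Suc (Suc j)) \<le> real (j + 2) * b (Suc j)"
    by linarith
  then show ?thesis
    unfolding b_def by (simp add: mult_le_cancel_left_pos)
qed

theorem mainTheorem1:
  fixes P :: "real poly" and m :: nat and d :: real
  assumes "0 < m"
    and "degree P = m"
    and "\<forall>i\<le>m. 0 \<le> coeff P i"
    and "\<forall>i<m. coeff P i \<le> coeff P (Suc i)"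
    and "0 < d"
  shows "unimodal_poly (pcompose P [:d, 1:])"
proof -
  define b where "b = coeff (pcompose P [:d, 1:])"
  have deg: "degree (pcompose P [:d, 1:]) = m"
    by (simp add: degree_pcompose assms(2))
  have nonneg: "0 \<le> coeff P i" for i
    using assms(2,3) by (cases "i \<le> m") (auto simp: coeff_eq_0)
  have b_nonneg: "0 \<le> b i" for i
    unfolding b_def using nonneg \<open>0 < d\<close> by (intro coeff_pcompose_shift_nonneg) auto
  have step: "b (Suc (Suc j)) \<le> b (Suc j)" if "b (Suc j) \<le> b j" for j
    using that assms nonneg unfolding b_def by (intro descent_step) auto
  define t where "t = (LEAST j. b (Suc j) \<le> b j)"
  \<comment> \<open>The coefficient after the leading one is \<open>0\<close>, so the first descent is at \<open>m\<close> or earlier.\<close>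
  have m: "b (Suc m) \<le> b m"
    using b_nonneg[of m] by (simp add: b_def coeff_eq_0 deg)
  have "t \<le> m"
    unfolding t_def by (rule Least_le) (fact m)
  moreover have "b i \<le> b (Suc i)" if "i < t" for i
    using not_less_Least[OF that[unfolded t_def]] by simp
  moreover have "b (Suc i) \<le> b i" if "t \<le> i" for i
    using that
  proof (induction i rule: dec_induct)
    case base
    show ?case unfolding t_def by (rule LeastI) (fact m)
  qed (rule step)
  ultimately show ?thesis
    using b_nonneg unfolding unimodal_poly_def unimodal_seq_def deg b_def by blast
qed

end
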